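(* Let $q$ be a prime power and $1\le t\le s$. If there is a linear $(t,s,q)$-AONT, then there is a linear $(s,s-t,t,q)$-resilient function.
   Context: A linear $(t,s,q)$-AONT is an invertible $s\times s$ matrix $M$ over $\mathbb{F}_q$ such that the map $\mathbf{y}\mapsto\mathbf{y}M$ is an all-or-nothing transform with parameter $t$; equivalently (a known fact), an invertible $s\times s$ matrix over $\mathbb{F}_q$ every $t\times t$ submatrix of which is invertible. For a finite set $X$ with $|X|=v$, an $(n,m,t,v)$-resilient function is a function $g: X^n\to X^m$ such that if any $t$ of the $n$ input values are fixed and the remaining $n-t$ inputs are chosen independently and uniformly at random, then every output $m$-tuple occurs with probability exactly $1/v^m$. An $(n,m,t,q)$-resilient function $f$ over $\mathbb{F}_q$ is linear if $f(\mathbf{x}) = \mathbf{x}N^T$ for some $m\times n$ matrix $N$ over $\mathbb{F}_q$. *)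

theory Defs
  imports
    "HOL-Probability.Probability"
    "HOL-Number_Theory.Prime_Powers"
    "Jordan_Normal_Form.DL_Submatrix"
    "Jordan_Normal_Form.Determinant"
begin

no_notation Finite_Cartesian_Product.vec.vec_nth (infixl \<open>$\<close> 90)

definition tuples :: "'a set \<Rightarrow> nat \<Rightarrow> 'a vec set" where
  "tuples X n = {x \<in> carrier_vec n. \<forall>i<n. x $ i \<in> X}"

abbreviation vec_mult_mat :: "'a::comm_semiring_0 vec \<Rightarrow> 'a mat \<Rightarrow> 'a vec"
    (infixl \<open>\<^sub>v*\<close> 70) where
  "x \<^sub>v* A \<equiv> A\<^sup>T *\<^sub>v x"

text \<open>
  All-or-nothing transforms, in the information-theoretic sense: for uniformly distributed
  inputs \<open>x\<close>, learning any \<open>s - t\<close> of the outputs \<open>\<phi> x\<close> does not change the distribution of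
  any \<open>t\<close> of the inputs. Only the entries of \<open>a\<close> in \<open>I\<close> and of \<open>b\<close> in \<open>J\<close> matter.
\<close>

definition aont :: "nat \<Rightarrow> nat \<Rightarrow> nat \<Rightarrow> 'a set \<Rightarrow> ('a vec \<Rightarrow> 'a vec) \<Rightarrow> bool" where
  "aont t s v X \<phi> \<longleftrightarrow>
     finite X \<and> X \<noteq> {} \<and> card X = v \<and>
     bij_betw \<phi> (tuples X s) (tuples X s) \<and>
     (\<forall>I J a b. I \<subseteq> {..<s} \<longrightarrow> card I = t \<longrightarrow> J \<subseteq> {..<s} \<longrightarrow> card J = s - t \<longrightarrow>
        a \<in> tuples X s \<longrightarrow> b \<in> tuples X s \<longrightarrow>
        \<P>(x in measure_pmf (pmf_of_set (tuples X s)).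
            (\<forall>i\<in>I. x $ i = a $ i) \<bar> (\<forall>j\<in>J. \<phi> x $ j = b $ j)) =
        \<P>(x in measure_pmf (pmf_of_set (tuples X s)). \<forall>i\<in>I. x $ i = a $ i))"

text \<open>
  The field \<open>\<F>\<^sub>q\<close> is a finite field type with \<open>q\<close> elements. The matrix \<open>M\<close> of a linear
  transform \<open>\<phi>\<close> computes the inputs from the outputs: \<open>y = \<phi> x\<close> iff \<open>x = y M\<close>. This is the
  orientation for which the condition is equivalent to all \<open>t \<times> t\<close> submatrices of \<open>M\<close>
  being invertible, see \<open>linear_aont_iff_submatrices\<close> below; with the opposite orientation
  \<open>M\<close> would be replaced by its inverse.
\<close>

definition linear_aont :: "nat \<Rightarrow> nat \<Rightarrow> nat \<Rightarrow> 'a::{field,finite} mat \<Rightarrow> bool" where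
  "linear_aont t s q M \<longleftrightarrow>
     M \<in> carrier_mat s s \<and> invertible_mat M \<and>
     (\<exists>\<phi>. aont t s q UNIV \<phi> \<and> (\<forall>x\<in>carrier_vec s. x = \<phi> x \<^sub>v* M))"

text \<open>
  A random \<open>n\<close>-tuple whose entries at positions in \<open>T\<close> are those of \<open>a\<close>, the others being
  independent and uniform on \<open>X\<close>. (The \<open>undefined\<close> argument is the irrelevant default value
  of \<^const>\<open>Pi_pmf\<close> outside its index set.)
\<close>

definition partially_fixed_pmf :: "'a set \<Rightarrow> nat \<Rightarrow> nat set \<Rightarrow> 'a vec \<Rightarrow> 'a vec pmf" where
  "partially_fixed_pmf X n T a =
     map_pmf (\<lambda>r. vec n (\<lambda>i. if i \<in> T then a $ i else r i))
       (Pi_pmf ({..<n} - T) undefined (\<lambda>_. pmf_of_set X))"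

definition resilient_function ::
    "nat \<Rightarrow> nat \<Rightarrow> nat \<Rightarrow> nat \<Rightarrow> 'a set \<Rightarrow> ('a vec \<Rightarrow> 'a vec) \<Rightarrow> bool" where
  "resilient_function n m t v X g \<longleftrightarrow>
     finite X \<and> X \<noteq> {} \<and> card X = v \<and>
     g \<in> tuples X n \<rightarrow> tuples X m \<and>
     (\<forall>T a y. T \<subseteq> {..<n} \<longrightarrow> card T = t \<longrightarrow> a \<in> tuples X n \<longrightarrow> y \<in> tuples X m \<longrightarrow>
        \<P>(x in measure_pmf (partially_fixed_pmf X n T a). g x = y) = 1 / real v ^ m)"

definition linear_resilient_function ::
    "nat \<Rightarrow> nat \<Rightarrow> nat \<Rightarrow> nat \<Rightarrow> ('a::{field,finite} vec \<Rightarrow> 'a vec) \<Rightarrow> bool" where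
  "linear_resilient_function n m t q f \<longleftrightarrow>
     resilient_function n m t q UNIV f \<and>
     (\<exists>N\<in>carrier_mat m n. \<forall>x\<in>carrier_vec n. f x = x \<^sub>v* N\<^sup>T)"

text \<open>
  The remaining lemmas show that \<^const>\<open>linear_aont\<close> agrees with the usual characterization
  by submatrices. The lemma \<open>aont_iff\<close> reduces the probabilistic condition to solvability:
  any \<open>t\<close> inputs are compatible with any \<open>s - t\<close> outputs.
\<close>

lemma tuples_bij:
  "bij_betw (\<lambda>x. restrict (($) x) {..<n}) (tuples X n) (PiE {..<n} (\<lambda>_. X))"
proof (rule bij_betw_byWitness[where f' = "\<lambda>f. Matrix.vec n f"])
qed (auto simp: tuples_def PiE_def extensional_def restrict_def intro!: eq_vecI ext)

lemma card_tuples_fixed: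
  assumes "finite X" "I \<subseteq> {..<n}" "a \<in> tuples X n"
  shows "card {x \<in> tuples X n. \<forall>i\<in>I. x $ i = a $ i} = card X ^ (n - card I)"
proof -
  have "bij_betw (\<lambda>x. restrict (($) x) ({..<n} - I)) {x \<in> tuples X n. \<forall>i\<in>I. x $ i = a $ i}
      (PiE ({..<n} - I) (\<lambda>_. X))"
  proof (rule bij_betw_byWitness[where f' = "\<lambda>f. Matrix.vec n (\<lambda>i. if i \<in> I then a $ i else f i)"])
  qed (use assms in \<open>auto simp: tuples_def PiE_def extensional_def restrict_def intro!: eq_vecI ext\<close>)
  from bij_betw_same_card[OF this] show ?thesis
    using assms by (simp add: card_PiE card_Diff_subset finite_subset)
qed

lemma finite_tuples: "finite X \<Longrightarrow> finite (tuples X n)"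
  using bij_betw_finite[OF tuples_bij[of n X]] by (auto intro: finite_PiE)

lemma card_tuples: "finite X \<Longrightarrow> card (tuples X n) = card X ^ n"
  using bij_betw_same_card[OF tuples_bij[of n X]] by (simp add: card_PiE)

lemma tuples_nonempty: "X \<noteq> {} \<Longrightarrow> tuples X n \<noteq> {}"
proof -
  assume "X \<noteq> {}"
  then obtain c where "c \<in> X" by auto
  then have "Matrix.vec n (\<lambda>_. c) \<in> tuples X n" by (auto simp: tuples_def)
  then show ?thesis by auto
qed

lemma prob_tuples:
  assumes "finite X" "X \<noteq> {}"
  shows "\<P>(x in measure_pmf (pmf_of_set (tuples X n)). P x) =
    card {x \<in> tuples X n. P x} / card X ^ n"
  using assms by (simp add: measure_pmf_of_set finite_tuples tuples_nonempty card_tuples Int_def)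

lemma aont_iff:
  assumes X: "finite X" "X \<noteq> {}" and ts: "t \<le> s"
  shows "aont t s (card X) X \<phi> \<longleftrightarrow> bij_betw \<phi> (tuples X s) (tuples X s) \<and>
     (\<forall>I J a b. I \<subseteq> {..<s} \<longrightarrow> card I = t \<longrightarrow> J \<subseteq> {..<s} \<longrightarrow> card J = s - t \<longrightarrow>
        a \<in> tuples X s \<longrightarrow> b \<in> tuples X s \<longrightarrow>
        (\<exists>x\<in>tuples X s. (\<forall>i\<in>I. x $ i = a $ i) \<and> (\<forall>j\<in>J. \<phi> x $ j = b $ j)))"
    (is "_ \<longleftrightarrow> ?bij \<and> ?R")
proof (cases ?bij)
  case bij: True
  have pos: "card X > 0" using X by (simp add: card_gt_0_iff)
  have PI: "\<P>(x in measure_pmf (pmf_of_set (tuples X s)). \<forall>i\<in>I. x $ i = a $ i) = 1 / card X ^ t"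
    if "I \<subseteq> {..<s}" "card I = t" "a \<in> tuples X s" for I a
    unfolding prob_tuples[OF X] card_tuples_fixed[OF X(1) that(1,3)]
    using that pos ts by (simp add: field_simps flip: power_add)
  have cJ: "card {x \<in> tuples X s. \<forall>j\<in>J. \<phi> x $ j = b $ j} = card X ^ t"
    if "J \<subseteq> {..<s}" "card J = s - t" "b \<in> tuples X s" for J b
  proof -
    have "bij_betw \<phi> {x \<in> tuples X s. \<forall>j\<in>J. \<phi> x $ j = b $ j} {y \<in> tuples X s. \<forall>j\<in>J. y $ j = b $ j}"
      using bij unfolding bij_betw_def inj_on_def by auto
    from bij_betw_same_card[OF this] show ?thesis
      using card_tuples_fixed[OF X(1) that(1,3)] that ts by simp
  qed
  have cond: "\<P>(x in measure_pmf (pmf_of_set (tuples X s)).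
        (\<forall>i\<in>I. x $ i = a $ i) \<bar> (\<forall>j\<in>J. \<phi> x $ j = b $ j)) =
      card {x \<in> tuples X s. (\<forall>i\<in>I. x $ i = a $ i) \<and> (\<forall>j\<in>J. \<phi> x $ j = b $ j)} / card X ^ t"
    if "J \<subseteq> {..<s}" "card J = s - t" "b \<in> tuples X s" for I J a b
    using pos by (simp add: cond_prob_def prob_tuples[OF X, simplified] cJ[OF that])
  have one: "card {x \<in> tuples X s. (\<forall>i\<in>I. x $ i = a $ i) \<and> (\<forall>j\<in>J. \<phi> x $ j = b $ j)} = 1"
    if R: ?R and IJ: "I \<subseteq> {..<s}" "card I = t" "J \<subseteq> {..<s}" "card J = s - t"
      "a \<in> tuples X s" "b \<in> tuples X s" for I J a b
  proof -
    define B where "B = {x \<in> tuples X s. \<forall>j\<in>J. \<phi> x $ j = b $ j}"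
    define r where "r = (\<lambda>x::'a Matrix.vec. restrict (($) x) I)"
    have "r ` B = PiE I (\<lambda>_. X)"
    proof (intro equalityI subsetI)
      fix f assume "f \<in> r ` B" then show "f \<in> PiE I (\<lambda>_. X)"
        using IJ(1) by (auto simp: B_def r_def tuples_def)
    next
      fix f assume f: "f \<in> PiE I (\<lambda>_. X)"
      define a' where "a' = Matrix.vec s (\<lambda>i. if i \<in> I then f i else a $ i)"
      have "a' \<in> tuples X s" using f IJ(5) by (auto simp: a'_def tuples_def)
      with R IJ obtain x where x: "x \<in> B" "\<forall>i\<in>I. x $ i = a' $ i"
        unfolding B_def by blast
      have "r x = f" using x(2) f IJ(1)
        by (auto simp: r_def a'_def PiE_def extensional_def restrict_def fun_eq_iff subset_iff)
      with x(1) show "f \<in> r ` B" by auto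
    qed
    moreover have "card (PiE I (\<lambda>_. X)) = card X ^ t"
      using IJ finite_subset[OF IJ(1)] by (simp add: card_PiE)
    moreover have "card B = card X ^ t" unfolding B_def by (rule cJ) (use IJ in auto)
    ultimately have "inj_on r B"
      by (intro eq_card_imp_inj_on) (auto simp: B_def finite_tuples[OF X(1)])
    moreover obtain x where x: "x \<in> B" "\<forall>i\<in>I. x $ i = a $ i"
      using R IJ unfolding B_def by blast
    ultimately have "{x \<in> B. \<forall>i\<in>I. x $ i = a $ i} = {x}"
      by (force simp: inj_on_def r_def restrict_def fun_eq_iff)
    then show ?thesis
      unfolding B_def by (simp add: conj_ac)
  qed
  show ?thesis
  proof
    assume A: "aont t s (card X) X \<phi>"
    have "\<exists>x\<in>tuples X s. (\<forall>i\<in>I. x $ i = a $ i) \<and> (\<forall>j\<in>J. \<phi> x $ j = b $ j)"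
      if IJ: "I \<subseteq> {..<s}" "card I = t" "J \<subseteq> {..<s}" "card J = s - t"
        "a \<in> tuples X s" "b \<in> tuples X s" for I J a b
    proof -
      have "\<P>(x in measure_pmf (pmf_of_set (tuples X s)).
          (\<forall>i\<in>I. x $ i = a $ i) \<bar> (\<forall>j\<in>J. \<phi> x $ j = b $ j)) = 1 / card X ^ t"
        using A[unfolded aont_def, THEN conjunct2, THEN conjunct2, THEN conjunct2, THEN conjunct2,
            rule_format, OF IJ] PI[OF IJ(1,2,5)] by (rule trans)
      then have "card {x \<in> tuples X s. (\<forall>i\<in>I. x $ i = a $ i) \<and> (\<forall>j\<in>J. \<phi> x $ j = b $ j)} \<noteq> 0"
        unfolding cond[OF IJ(3,4,6)] using pos by auto
      then show ?thesis by (auto simp: card_eq_0_iff)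
    qed
    then show "?bij \<and> ?R"
      by (intro conjI bij allI impI)
  next
    assume R: "?bij \<and> ?R"
    have eq: "\<P>(x in measure_pmf (pmf_of_set (tuples X s)).
          (\<forall>i\<in>I. x $ i = a $ i) \<bar> (\<forall>j\<in>J. \<phi> x $ j = b $ j)) =
        \<P>(x in measure_pmf (pmf_of_set (tuples X s)). \<forall>i\<in>I. x $ i = a $ i)"
      if IJ: "I \<subseteq> {..<s}" "card I = t" "J \<subseteq> {..<s}" "card J = s - t"
        "a \<in> tuples X s" "b \<in> tuples X s" for I J a b
      unfolding cond[OF IJ(3,4,6)] PI[OF IJ(1,2,5)] one[OF conjunct2[OF R] IJ] by simp
    show "aont t s (card X) X \<phi>"
      unfolding aont_def
      by (intro conjI allI impI X bij eq refl)
  qed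
qed (simp add: aont_def)

lemma bij_betw_pick:
  assumes "I \<subseteq> {..<s}"
  shows "bij_betw (pick I) {..<card I} I"
proof -
  have fin: "finite I" using assms finite_subset by blast
  have inj: "inj_on (pick I) {..<card I}"
    by (rule inj_onI) (metis card_pick lessThan_iff)
  moreover have "pick I ` {..<card I} \<subseteq> I" using pick_in_set by auto
  ultimately show ?thesis
    using fin by (simp add: bij_betw_def card_image card_subset_eq)
qed

lemma invertible_mat_surj:
  fixes A :: "'a::field mat"
  assumes A: "A \<in> carrier_mat n n"
  shows "invertible_mat A \<longleftrightarrow> (\<forall>w\<in>carrier_vec n. \<exists>z\<in>carrier_vec n. A *\<^sub>v z = w)"
proof
  assume "invertible_mat A"
  then obtain B where "A * B = 1\<^sub>m n" "B * A = 1\<^sub>m (dim_row B)"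
    using A unfolding invertible_mat_def inverts_mat_def by auto
  then have B: "B \<in> carrier_mat n n" "A * B = 1\<^sub>m n"
    using A by (metis carrier_matD carrier_matI index_mult_mat(2,3) index_one_mat(3))+
  show "\<forall>w\<in>carrier_vec n. \<exists>z\<in>carrier_vec n. A *\<^sub>v z = w"
  proof
    fix w :: "'a Matrix.vec" assume w: "w \<in> carrier_vec n"
    then have "A *\<^sub>v (B *\<^sub>v w) = w"
      using A B by (simp flip: assoc_mult_mat_vec)
    then show "\<exists>z\<in>carrier_vec n. A *\<^sub>v z = w"
      using B w by (intro bexI[of _ "B *\<^sub>v w"]) auto
  qed
next
  assume R: "\<forall>w\<in>carrier_vec n. \<exists>z\<in>carrier_vec n. A *\<^sub>v z = w"
  then have "\<forall>j. \<exists>z\<in>carrier_vec n. A *\<^sub>v z = unit_vec n j" by simp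
  then obtain c where c: "\<And>j. c j \<in> carrier_vec n" "\<And>j. A *\<^sub>v c j = unit_vec n j" by metis
  define B where "B = mat_of_cols n (map c [0..<n])"
  have B: "B \<in> carrier_mat n n" unfolding B_def by (rule mat_of_cols_carrier(1)[of n "map c [0..<n]", simplified])
  have "A * B = 1\<^sub>m n"
  proof (rule eq_matI)
    fix i j assume ij: "i < dim_row (1\<^sub>m n :: 'a mat)" "j < dim_col (1\<^sub>m n :: 'a mat)"
    have "(A * B) $$ (i, j) = (A *\<^sub>v c j) $ i"
      using ij A B c(1) by (simp add: B_def col_mat_of_cols)
    then show "(A * B) $$ (i, j) = 1\<^sub>m n $$ (i, j)"
      using ij c(2) by (auto simp: unit_vec_def)
  qed (use A B in auto)
  with mat_mult_left_right_inverse[OF A B this] show "invertible_mat A"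
    using A B unfolding invertible_mat_def inverts_mat_def by auto
qed

lemma invertible_mat_transpose:
  fixes A :: "'a::field mat"
  assumes A: "A \<in> carrier_mat n n" and "invertible_mat A"
  shows "invertible_mat A\<^sup>T"
proof -
  obtain B where "A * B = 1\<^sub>m n" "B * A = 1\<^sub>m (dim_row B)"
    using assms unfolding invertible_mat_def inverts_mat_def by auto
  then have B: "B \<in> carrier_mat n n" "A * B = 1\<^sub>m n" "B * A = 1\<^sub>m n"
    using A by (metis carrier_matD carrier_matI index_mult_mat(2,3) index_one_mat(3))+
  have "B\<^sup>T * A\<^sup>T = 1\<^sub>m n" "A\<^sup>T * B\<^sup>T = 1\<^sub>m n"
    by (simp_all add: B(2,3) flip: transpose_mult[OF A B(1)] transpose_mult[OF B(1) A])
  then show ?thesis using A B unfolding invertible_mat_def inverts_mat_def by auto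
qed

lemma tuples_UNIV [simp]: "tuples UNIV n = carrier_vec n"
  by (auto simp: tuples_def)

lemma submatrix_mult:
  fixes M :: "'a::comm_semiring_0 mat"
  assumes M: "M \<in> carrier_mat s s" and K: "K \<subseteq> {..<s}" "card K = t"
    and I: "I \<subseteq> {..<s}" "card I = t" and r: "r < t" and z: "z \<in> carrier_vec t"
    and y: "y \<in> carrier_vec s" "\<And>p. p < t \<Longrightarrow> y $ pick K p = z $ p"
  shows "(y \<^sub>v* M) $ pick I r =
    (z \<^sub>v* submatrix M K I) $ r + (\<Sum>k\<in>{..<s}-K. M $$ (k, pick I r) * y $ k)"
proof -
  have Ks: "{i. i < s \<and> i \<in> K} = K" "{i. i < s \<and> i \<in> I} = I" using K I by auto
  have pI: "pick I r < s" using pick_in_set[of r I] r I by auto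
  have "(y \<^sub>v* M) $ pick I r = (\<Sum>k<s. M $$ (k, pick I r) * y $ k)"
    using M y pI by (auto simp: scalar_prod_def lessThan_atLeast0 intro!: sum.cong)
  also have "\<dots> = (\<Sum>k\<in>K. M $$ (k, pick I r) * y $ k)
      + (\<Sum>k\<in>{..<s}-K. M $$ (k, pick I r) * y $ k)"
    using K by (subst sum.subset_diff[of K]) (auto simp: add.commute)
  also have "(\<Sum>k\<in>K. M $$ (k, pick I r) * y $ k) = (\<Sum>p<t. M $$ (pick K p, pick I r) * z $ p)"
    using sum.reindex_bij_betw[OF bij_betw_pick[OF K(1)], of "\<lambda>k. M $$ (k, pick I r) * y $ k"] K y(2)
    by simp
  also have "\<dots> = (z \<^sub>v* submatrix M K I) $ r"
    using M z r K(2) I(2) Ks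
    by (auto simp: scalar_prod_def submatrix_def lessThan_atLeast0 intro!: sum.cong)
  finally show ?thesis .
qed

lemma linear_aont_iff_submatrices:
  fixes M :: "'a::{field,finite} mat"
  assumes "t \<le> s"
  shows "linear_aont t s CARD('a) M \<longleftrightarrow>
    M \<in> carrier_mat s s \<and> invertible_mat M \<and>
    (\<forall>K I. K \<subseteq> {..<s} \<longrightarrow> card K = t \<longrightarrow> I \<subseteq> {..<s} \<longrightarrow> card I = t \<longrightarrow>
       invertible_mat (submatrix M K I))"
    (is "_ \<longleftrightarrow> ?C \<and> ?D \<and> ?S")
proof (cases "?C \<and> ?D")
  case True
  then have M: ?C and inv: ?D by auto
  define \<psi> where "\<psi> = (\<lambda>y. y \<^sub>v* M)"
  have surj: "\<psi> ` carrier_vec s = carrier_vec s"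
    using M invertible_mat_transpose[OF M inv] invertible_mat_surj[of "M\<^sup>T" s]
    unfolding \<psi>_def image_def by (auto; metis)
  have fin: "finite (carrier_vec s :: 'a Matrix.vec set)"
    using finite_tuples[of "UNIV :: 'a set" s] by simp
  have bij: "bij_betw \<psi> (carrier_vec s) (carrier_vec s)"
    using surj fin by (simp add: bij_betw_def eq_card_imp_inj_on)
  have sub_dim: "submatrix M K I \<in> carrier_mat t t" if "K \<subseteq> {..<s}" "card K = t" "I \<subseteq> {..<s}" "card I = t" for K I
  proof -
    have "{i. i < s \<and> i \<in> K} = K" "{i. i < s \<and> i \<in> I} = I" using that by auto
    then show ?thesis using M that by (auto simp: submatrix_def)
  qed
  have tt: "invertible_mat A\<^sup>T \<longleftrightarrow> invertible_mat A" if "A \<in> carrier_mat t t" for A :: "'a mat"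
    using invertible_mat_transpose[of A t] invertible_mat_transpose[of "A\<^sup>T" t] that by auto
  have pickE: "\<exists>r<card I. i = pick I r" if "I \<subseteq> {..<s}" "i \<in> I" for I i
    using bij_betw_pick[OF that(1)] that(2) by (auto simp: bij_betw_def image_def)
  define Q where "Q = (\<forall>I J a b. I \<subseteq> {..<s} \<longrightarrow> card I = t \<longrightarrow> J \<subseteq> {..<s} \<longrightarrow> card J = s - t \<longrightarrow>
      a \<in> carrier_vec s \<longrightarrow> b \<in> carrier_vec s \<longrightarrow>
      (\<exists>y\<in>carrier_vec s. (\<forall>i\<in>I. \<psi> y $ i = a $ i) \<and> (\<forall>j\<in>J. y $ j = b $ j)))"
  have "linear_aont t s CARD('a) M \<longleftrightarrow> Q"
  proof
    assume "linear_aont t s CARD('a) M"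
    then obtain \<phi> where \<phi>: "aont t s CARD('a) UNIV \<phi>" "\<And>x. x \<in> carrier_vec s \<Longrightarrow> \<psi> (\<phi> x) = x"
      unfolding linear_aont_def \<psi>_def by metis
    from \<phi>(1)[unfolded aont_iff[OF finite UNIV_not_empty assms]]
    have b: "bij_betw \<phi> (carrier_vec s) (carrier_vec s)" and
      R: "\<And>I J a b. I \<subseteq> {..<s} \<Longrightarrow> card I = t \<Longrightarrow> J \<subseteq> {..<s} \<Longrightarrow> card J = s - t \<Longrightarrow>
        a \<in> carrier_vec s \<Longrightarrow> b \<in> carrier_vec s \<Longrightarrow>
        (\<exists>x\<in>carrier_vec s. (\<forall>i\<in>I. x $ i = a $ i) \<and> (\<forall>j\<in>J. \<phi> x $ j = b $ j))" by auto
    show Q unfolding Q_def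
    proof (intro allI impI)
      fix I J and a b :: "'a Matrix.vec" assume IJ: "I \<subseteq> {..<s}" "card I = t" "J \<subseteq> {..<s}" "card J = s - t"
        "a \<in> carrier_vec s" "b \<in> carrier_vec s"
      from R[OF this] obtain x where x: "x \<in> carrier_vec s" "\<forall>i\<in>I. x $ i = a $ i" "\<forall>j\<in>J. \<phi> x $ j = b $ j"
        by blast
      then show "\<exists>y\<in>carrier_vec s. (\<forall>i\<in>I. \<psi> y $ i = a $ i) \<and> (\<forall>j\<in>J. y $ j = b $ j)"
        using \<phi>(2)[OF x(1)] bij_betwE[OF b] by (intro bexI[of _ "\<phi> x"]) auto
    qed
  next
    assume Q: Q
    define \<phi> where "\<phi> = the_inv_into (carrier_vec s) \<psi>"
    have b: "bij_betw \<phi> (carrier_vec s) (carrier_vec s)"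
      unfolding \<phi>_def using bij by (rule bij_betw_the_inv_into)
    have inv1: "\<psi> (\<phi> x) = x" if "x \<in> carrier_vec s" for x
      unfolding \<phi>_def using f_the_inv_into_f_bij_betw[OF bij] that by blast
    have inv2: "\<phi> (\<psi> y) = y" if "y \<in> carrier_vec s" for y
      unfolding \<phi>_def using bij that by (simp add: bij_betw_def the_inv_into_f_f)
    have ca: "\<psi> y \<in> carrier_vec s" if "y \<in> carrier_vec s" for y using surj that by auto
    have "aont t s CARD('a) UNIV \<phi>"
      unfolding aont_iff[OF finite UNIV_not_empty assms] tuples_UNIV
    proof (intro conjI b allI impI)
      fix I J and a b :: "'a Matrix.vec" assume IJ: "I \<subseteq> {..<s}" "card I = t" "J \<subseteq> {..<s}" "card J = s - t"
        "a \<in> carrier_vec s" "b \<in> carrier_vec s"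
      with Q obtain y where y: "y\<in>carrier_vec s" "\<forall>i\<in>I. \<psi> y $ i = a $ i" "\<forall>j\<in>J. y $ j = b $ j"
        unfolding Q_def by blast
      then show "\<exists>x\<in>carrier_vec s. (\<forall>i\<in>I. x $ i = a $ i) \<and> (\<forall>j\<in>J. \<phi> x $ j = b $ j)"
        using inv2 ca by (intro bexI[of _ "\<psi> y"]) auto
    qed
    then show "linear_aont t s CARD('a) M"
      unfolding linear_aont_def using True inv1 unfolding \<psi>_def by metis
  qed
  also have "Q \<longleftrightarrow> ?S"
  proof
    assume Q: Q
    show ?S
    proof (intro allI impI)
      fix K I assume KI: "K \<subseteq> {..<s}" "card K = t" "I \<subseteq> {..<s}" "card I = t"
      note sd = sub_dim[OF KI]
      have cJ: "card ({..<s} - K) = s - t"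
        using KI finite_subset[OF KI(1)] by (simp add: card_Diff_subset)
      have "\<exists>z\<in>carrier_vec t. z \<^sub>v* submatrix M K I = w" if w: "w \<in> carrier_vec t" for w
      proof -
        define a where "a = Matrix.vec s (\<lambda>i. w $ card {j\<in>I. j < i})"
        have "a \<in> carrier_vec s" by (simp add: a_def)
        with Q KI cJ obtain y where y: "y\<in>carrier_vec s" "\<forall>i\<in>I. \<psi> y $ i = a $ i"
          "\<forall>j\<in>{..<s}-K. y $ j = 0\<^sub>v s $ j"
          unfolding Q_def by (metis Diff_subset zero_carrier_vec)
        define z where "z = Matrix.vec t (\<lambda>p. y $ pick K p)"
        have "z \<^sub>v* submatrix M K I = w"
        proof (rule eq_vecI)
          fix r assume "r < dim_vec w"
          then have r: "r < t" using w by simp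
          have pI: "pick I r \<in> I" using pick_in_set r KI by auto
          have "(\<Sum>k\<in>{..<s}-K. M $$ (k, pick I r) * y $ k) = 0"
            using y(3) by (intro sum.neutral) auto
          with submatrix_mult[OF M KI r _ y(1), of z]
          have "(z \<^sub>v* submatrix M K I) $ r = \<psi> y $ pick I r"
            by (simp add: z_def \<psi>_def)
          also have "\<dots> = a $ pick I r" using y(2) pI by auto
          also have "\<dots> = w $ r" using pI KI r by (auto simp: a_def card_pick subset_iff)
          finally show "(z \<^sub>v* submatrix M K I) $ r = w $ r" .
        qed (use sd w in auto)
        then show ?thesis by (intro bexI[of _ z]) (simp_all add: z_def)
      qed
      then show "invertible_mat (submatrix M K I)"
        using invertible_mat_surj[of "(submatrix M K I)\<^sup>T" t] sd tt[OF sd] by auto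
    qed
  next
    assume S: ?S
    show Q unfolding Q_def
    proof (intro allI impI)
      fix I J and a b :: "'a Matrix.vec" assume IJ: "I \<subseteq> {..<s}" "card I = t" "J \<subseteq> {..<s}" "card J = s - t"
        "a \<in> carrier_vec s" "b \<in> carrier_vec s"
      define K where "K = {..<s} - J"
      have KI: "K \<subseteq> {..<s}" "card K = t" "I \<subseteq> {..<s}" "card I = t"
        using IJ finite_subset[OF IJ(3)] assms by (auto simp: K_def card_Diff_subset)
      have J: "J = {..<s} - K" using IJ by (auto simp: K_def)
      note sd = sub_dim[OF KI]
      define w where "w = Matrix.vec t (\<lambda>r. a $ pick I r - (\<Sum>k\<in>{..<s}-K. M $$ (k, pick I r) * b $ k))"
      have "invertible_mat (submatrix M K I)\<^sup>T" using S KI tt[OF sd] by auto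
      moreover have "w \<in> carrier_vec t" by (simp add: w_def)
      ultimately obtain z where z: "z \<in> carrier_vec t" "z \<^sub>v* submatrix M K I = w"
        using invertible_mat_surj[of "(submatrix M K I)\<^sup>T" t] sd by auto
      define y where "y = Matrix.vec s (\<lambda>k. if k \<in> K then z $ card {j\<in>K. j < k} else b $ k)"
      have y: "y \<in> carrier_vec s" by (simp add: y_def)
      have yp: "y $ pick K p = z $ p" if "p < t" for p
        using pick_in_set[of p K] that KI by (auto simp: y_def card_pick subset_iff)
      have "\<psi> y $ i = a $ i" if i: "i \<in> I" for i
      proof -
        obtain r where r: "r < t" "i = pick I r" using pickE[OF KI(3) i] KI by auto
        have "(\<Sum>k\<in>{..<s}-K. M $$ (k, pick I r) * y $ k) = (\<Sum>k\<in>{..<s}-K. M $$ (k, pick I r) * b $ k)"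
          by (intro sum.cong) (auto simp: y_def)
        with submatrix_mult[OF M KI r(1) z(1) y yp] show ?thesis
          unfolding z(2) using r by (simp add: \<psi>_def w_def)
      qed
      moreover have "\<forall>j\<in>J. y $ j = b $ j" using J by (auto simp: y_def)
      ultimately show "\<exists>y\<in>carrier_vec s. (\<forall>i\<in>I. \<psi> y $ i = a $ i) \<and> (\<forall>j\<in>J. y $ j = b $ j)"
        using y by blast
    qed
  qed
  finally show ?thesis using True by auto
qed (auto simp: linear_aont_def)

end

(* Truncate the inverse transform x |-> x M^-1 to its first s - t outputs. The AONT property says
   that any t prescribed inputs are compatible with any values of these s - t outputs, so the
   truncation maps the q^(s-t) inputs with t prescribed entries onto the q^(s-t) output tuples.
   Counting makes it a bijection there, and uniform inputs yield uniform outputs. *)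

theory Submission
  imports Defs
begin

text \<open>A product of uniform distributions is uniform on the product set, and inserting the
  prescribed entries maps this set bijectively onto the slice of tuples that agree with
  \<open>a\<close> on \<open>T\<close>. Resilience thus becomes a matter of counting.\<close>

lemma partially_fixed_pmf_eq_pmf_of_set:
  assumes X: "finite X" "X \<noteq> {}" and T: "T \<subseteq> {..<n}" and a: "a \<in> tuples X n"
  shows "partially_fixed_pmf X n T a = pmf_of_set {x \<in> tuples X n. \<forall>i\<in>T. x $ i = a $ i}"
proof -
  let ?A = "{..<n} - T"
  let ?D = "PiE_dflt ?A undefined (\<lambda>_. X)"
  let ?h = "\<lambda>r. Matrix.vec n (\<lambda>i. if i \<in> T then a $ i else r i)"
  have bij: "bij_betw ?h ?D {x \<in> tuples X n. \<forall>i\<in>T. x $ i = a $ i}"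
    \<comment> \<open>The value \<open>undefined\<close> off \<open>?A\<close> is the default built
      into \<open>?D\<close>; any other value would leave \<open>?D\<close>.\<close>
    by (rule bij_betw_byWitness[where f' = "\<lambda>x i. if i \<in> ?A then x $ i else undefined"])
      (use T a in \<open>auto simp: tuples_def PiE_dflt_def fun_eq_iff intro!: eq_vecI\<close>)
  have D: "finite ?D" "?D \<noteq> {}"
    using X by (auto intro!: finite_PiE_dflt simp: PiE_dflt_empty_iff)
  have "Pi_pmf ?A undefined (\<lambda>_. pmf_of_set X) = pmf_of_set ?D"
    using X by (intro Pi_pmf_of_set) auto
  then show ?thesis
    unfolding partially_fixed_pmf_def using map_pmf_of_set_bij_betw[OF bij D(2,1)] by simp
qed

text \<open>Mere surjectivity on every slice suffices: slice and codomain both have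
  \<open>card X ^ (n - t)\<close> elements, so \<open>g\<close> is a bijection between them and
  carries the uniform distribution to the uniform one.\<close>

lemma resilient_functionI:
  assumes X: "finite X" "X \<noteq> {}" and tn: "t \<le> n"
    and g: "g \<in> tuples X n \<rightarrow> tuples X (n - t)"
    and ex: "\<And>T a y. T \<subseteq> {..<n} \<Longrightarrow> card T = t \<Longrightarrow> a \<in> tuples X n \<Longrightarrow> y \<in> tuples X (n - t) \<Longrightarrow>
      \<exists>x\<in>tuples X n. (\<forall>i\<in>T. x $ i = a $ i) \<and> g x = y"
  shows "resilient_function n (n - t) t (card X) X g"
  unfolding resilient_function_def
proof (intro conjI X g refl allI impI)
  fix T a y
  assume T: "T \<subseteq> {..<n}" "card T = t" and a: "a \<in> tuples X n" and y: "y \<in> tuples X (n - t)"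
  define F where "F = {x \<in> tuples X n. \<forall>i\<in>T. x $ i = a $ i}"
  have fin: "finite F" using finite_tuples[OF X(1)] by (simp add: F_def)
  have F: "card F = card X ^ (n - t)"
    unfolding F_def card_tuples_fixed[OF X(1) T(1) a] T(2) ..
  have im: "g ` F = tuples X (n - t)"
    using g ex[OF T a] unfolding F_def by blast
  then have "inj_on g F"
    using fin F by (intro eq_card_imp_inj_on) (simp_all add: card_tuples[OF X(1)])
  then have bij: "bij_betw g F (tuples X (n - t))"
    using im by (simp add: bij_betw_def)
  have ne: "F \<noteq> {}" using a by (auto simp: F_def)
  have "map_pmf g (partially_fixed_pmf X n T a) = pmf_of_set (tuples X (n - t))"
    using map_pmf_of_set_bij_betw[OF bij ne fin]
    by (simp add: partially_fixed_pmf_eq_pmf_of_set[OF X T(1) a] F_def)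
  moreover have "\<P>(x in measure_pmf (partially_fixed_pmf X n T a). g x = y) =
      pmf (map_pmf g (partially_fixed_pmf X n T a)) y"
    by (simp add: pmf_map vimage_def)
  ultimately show "\<P>(x in measure_pmf (partially_fixed_pmf X n T a). g x = y) =
      1 / real (card X) ^ (n - t)"
    using y X by (simp add: finite_tuples tuples_nonempty card_tuples)
qed

text \<open>Since \<open>M\<close> recovers inputs from outputs, the transform itself is
  multiplication by the inverse \<open>L\<close> of the transpose of \<open>M\<close>.\<close>

lemma linear_aont_inverse:
  fixes M :: "'a::{field,finite} mat"
  assumes "linear_aont t s q M"
  obtains \<phi> and L :: "'a mat" where "aont t s q UNIV \<phi>" "L \<in> carrier_mat s s"
    "\<And>x. x \<in> carrier_vec s \<Longrightarrow> \<phi> x = L *\<^sub>v x"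
proof -
  from assms obtain \<phi> where M: "M \<in> carrier_mat s s" "invertible_mat M"
    and \<phi>: "aont t s q UNIV \<phi>" "\<And>x. x \<in> carrier_vec s \<Longrightarrow> M\<^sup>T *\<^sub>v \<phi> x = x"
    unfolding linear_aont_def by metis
  have MT: "M\<^sup>T \<in> carrier_mat s s" using M by simp
  from invertible_mat_transpose[OF M] obtain L where
    "L * M\<^sup>T = 1\<^sub>m (dim_row L)" "M\<^sup>T * L = 1\<^sub>m s"
    using MT unfolding invertible_mat_def inverts_mat_def by auto
  \<comment> \<open>The size of \<open>L\<close> is read off from the dimensions in the two product
    equations.\<close>
  then have L: "L \<in> carrier_mat s s" "L * M\<^sup>T = 1\<^sub>m s"
    using MT by (metis carrier_matD carrier_matI index_mult_mat(2,3) index_one_mat(3))+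
  have "\<phi> x = L *\<^sub>v x" if x: "x \<in> carrier_vec s" for x
  proof -
    have "\<phi> x \<in> carrier_vec s"
      using \<phi>(1) x by (auto simp: aont_def dest: bij_betwE)
    then have "\<phi> x = L *\<^sub>v (M\<^sup>T *\<^sub>v \<phi> x)"
      using assoc_mult_mat_vec[OF L(1) MT] L(2) by simp
    then show ?thesis using \<phi>(2)[OF x] by simp
  qed
  then show thesis by (rule that[OF \<phi>(1) L(1)])
qed

theorem theorem21:
  fixes q s t :: nat
  assumes "primepow q"
    and "CARD('a::{field,finite}) = q"
    and "1 \<le> t" and "t \<le> s"
    and "\<exists>M :: 'a mat. linear_aont t s q M"
  shows "\<exists>f :: 'a vec \<Rightarrow> 'a vec. linear_resilient_function s (s - t) t q f"
proof -
  from assms(5) obtain M :: "'a mat" where "linear_aont t s q M" ..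
  then obtain \<phi> and L :: "'a mat" where \<phi>: "aont t s q UNIV \<phi>"
    and L: "L \<in> carrier_mat s s" "\<And>x. x \<in> carrier_vec s \<Longrightarrow> \<phi> x = L *\<^sub>v x"
    by (rule linear_aont_inverse) blast
  \<comment> \<open>The first \<open>s - t\<close> rows of \<open>L\<close>, so that
    \<open>N\<close> truncates the transform.\<close>
  define N where "N = Matrix.mat (s - t) s (\<lambda>(i, j). L $$ (i, j))"
  have N: "N \<in> carrier_mat (s - t) s" by (simp add: N_def)
  have Nx: "(N *\<^sub>v x) $ j = \<phi> x $ j" if "x \<in> carrier_vec s" "j < s - t" for x j
    using that L by (auto simp: N_def scalar_prod_def)
  have ex: "\<exists>x\<in>tuples UNIV s. (\<forall>i\<in>T. x $ i = a $ i) \<and> N *\<^sub>v x = y"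
    if T: "T \<subseteq> {..<s}" "card T = t" and a: "a \<in> tuples UNIV s" and y: "y \<in> tuples UNIV (s - t)"
    for T a y
  proof -
    \<comment> \<open>Pads \<open>y\<close> to length \<open>s\<close>, as \<open>aont_iff\<close>
      expects; entries from \<open>s - t\<close> on are unspecified, but only those below are
      compared.\<close>
    let ?b = "Matrix.vec s (\<lambda>j. y $ j)"
    have "\<exists>x\<in>tuples UNIV s. (\<forall>i\<in>T. x $ i = a $ i) \<and> (\<forall>j\<in>{..<s - t}. \<phi> x $ j = ?b $ j)"
      using \<phi>[folded assms(2), unfolded aont_iff[OF finite UNIV_not_empty assms(4)],
          THEN conjunct2, rule_format, of T "{..<s - t}" a ?b] T a by simp
    then obtain x where x: "x \<in> carrier_vec s" "\<forall>i\<in>T. x $ i = a $ i"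
      "\<forall>j<s - t. \<phi> x $ j = ?b $ j"
      by auto
    have "N *\<^sub>v x = y"
    proof (rule eq_vecI)
      fix j assume "j < dim_vec y"
      then have "j < s - t" using y by simp
      \<comment> \<open>Without the deletion, simp would expand the product into a scalar product
        before \<open>Nx\<close> can apply.\<close>
      then show "(N *\<^sub>v x) $ j = y $ j" using x by (simp add: Nx del: index_mult_mat_vec)
    qed (use y N in auto)
    with x show ?thesis by auto
  qed
  have "resilient_function s (s - t) t q UNIV (\<lambda>x. N *\<^sub>v x)"
    unfolding assms(2)[symmetric]
    by (rule resilient_functionI[OF _ _ assms(4) _ ex]) (use N in auto)
  \<comment> \<open>In \<open>x \<^sub>v* N\<^sup>T\<close> the two transpositions cancel, leaving
    \<open>N *\<^sub>v x\<close>.\<close>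
  then have "linear_resilient_function s (s - t) t q (\<lambda>x. N *\<^sub>v x)"
    unfolding linear_resilient_function_def using N by auto
  then show ?thesis by blast
qed

end
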